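(* Let $m,n\ge 1$ and let $a_1,\ldots,a_m,b_1,\ldots,b_m,c_1,\ldots,c_n,d_1,\ldots,d_n$ be nonnegative integers with $a_i\le b_i$ for $1\le i\le m$, $c_j\le d_j$ for $1\le j\le n$, $b_1\ge b_2\ge\cdots\ge b_m$ and $d_1\ge d_2\ge \cdots\ge d_n$. Suppose that $$\sum_{i=1}^k b_i\le \sum_{i=1}^n \min\{c_i,k\}\quad\text{for each } k \text{ with } 1\le k\le m,$$ and $$\sum_{i=1}^l d_i\le \sum_{i=1}^m \min\{a_i,l\}\quad\text{for each } l \text{ with } 1\le l\le n.$$ Then every pair $(P;Q)$ with $P=(p_1,\ldots,p_m)$, $Q=(q_1,\ldots,q_n)$ of integers satisfying $a_i\le p_i\le b_i$ for $1\le i\le m$, $c_j\le q_j\le d_j$ for $1\le j\le n$, and $\sum_{i=1}^m p_i=\sum_{j=1}^n q_j$ is bigraphic.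
   Context: All graphs are finite, undirected, without loops or parallel edges. A pair $(P;Q)$ of sequences $P=(p_1,\ldots,p_m)$, $Q=(q_1,\ldots,q_n)$ of nonnegative integers is called bigraphic if there is a bipartite graph $G$ with partite sets $X=\{x_1,\ldots,x_m\}$ and $Y=\{y_1,\ldots,y_n\}$ such that $d_G(x_i)=p_i$ for $1\le i\le m$ and $d_G(y_j)=q_j$ for $1\le j\le n$. The data correspond to sequences of integer intervals $L_1=([a_1,b_1],\ldots,[a_m,b_m])$ and $L_2=([c_1,d_1],\ldots,[c_n,d_n])$. *)

theory Defs
  imports "Graph_Theory.Pair_Digraph"
begin

text \<open>
  A finite simple undirected graph is a \<^locale>\<open>pair_graph\<close>: the edge \<open>uv\<close> is represented by
  the two opposite arcs \<open>(u, v)\<close> and \<open>(v, u)\<close>. Hence the number of arcs leaving a vertex is the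
  number of edges incident with it.
\<close>

definition degree :: "'v pair_pre_digraph \<Rightarrow> 'v \<Rightarrow> nat" where
  "degree G v = out_degree (with_proj G) v"

definition bipartite :: "'v pair_pre_digraph \<Rightarrow> 'v set \<Rightarrow> 'v set \<Rightarrow> bool" where
  "bipartite G X Y \<longleftrightarrow>
     pair_graph G \<and> pverts G = X \<union> Y \<and> X \<inter> Y = {} \<and>
     (\<forall>(u, v) \<in> parcs G. u \<in> X \<and> v \<in> Y \<or> u \<in> Y \<and> v \<in> X)"

text \<open>
  A sequence \<open>p\<^sub>1, \<dots>, p\<^sub>m\<close> is a length \<open>m\<close> together with a function on \<^typ>\<open>nat\<close>, of which only
  the values on \<open>{1..m}\<close> matter. Since graphs are finite, it is no restriction to take natural
  numbers as vertices. Injectivity expresses that the listed vertices are pairwise distinct.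
\<close>

definition bigraphic :: "nat \<Rightarrow> nat \<Rightarrow> (nat \<Rightarrow> nat) \<Rightarrow> (nat \<Rightarrow> nat) \<Rightarrow> bool" where
  "bigraphic m n p q \<longleftrightarrow>
     (\<exists>(G :: nat pair_pre_digraph) x y.
        inj_on x {1..m} \<and> inj_on y {1..n} \<and>
        bipartite G (x ` {1..m}) (y ` {1..n}) \<and>
        (\<forall>i\<in>{1..m}. degree G (x i) = p i) \<and>
        (\<forall>j\<in>{1..n}. degree G (y j) = q j))"

end

theory Submission
  imports Defs
begin

text \<open>
  Since every \<open>p\<^sub>i\<close> is at most \<open>b\<^sub>i\<close> and every \<open>q\<^sub>j\<close> is at least \<open>c\<^sub>j\<close>, the first family of
  inequalities implies the Gale--Ryser condition for \<open>(P;Q)\<close>: any \<open>k\<close> of the \<open>p\<^sub>i\<close> have sum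
  at most \<open>\<Sum>\<^sub>j min q\<^sub>j k\<close>. Under that condition, vertices on one side are joined greedily, in
  any order, to the vertices of largest remaining capacity on the other side; one step preserves
  the condition. As the two sums agree, all capacities are used up in the end.
\<close>

text \<open>Grow \<open>T\<close> one element at a time, each new one a maximizer of
  \<open>q\<close> on what is left. Ties may be broken arbitrarily.\<close>

lemma ex_largest_subset:
  fixes q :: "'a \<Rightarrow> 'b::linorder"
  assumes "finite J" and "k \<le> card J"
  shows "\<exists>T\<subseteq>J. card T = k \<and> (\<forall>j\<in>T. \<forall>j'\<in>J - T. q j' \<le> q j)"
  using \<open>k \<le> card J\<close>
proof (induction k)
  case 0
  show ?case by (rule exI[of _ "{}"]) simp
next
  case (Suc k)
  then obtain T where T: "T \<subseteq> J" "card T = k" "\<forall>j\<in>T. \<forall>j'\<in>J - T. q j' \<le> q j"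
    by auto
  have "J - T \<noteq> {}"
    using Suc.prems T(1,2) by auto
  moreover have fin: "finite (J - T)"
    using assms(1) by simp
  ultimately have "Max (q ` (J - T)) \<in> q ` (J - T)"
    by (intro Max_in) auto
  then obtain t where t: "t \<in> J - T" "Max (q ` (J - T)) = q t"
    by auto
  have "\<forall>j\<in>J - T. q j \<le> q t"
    using fin by (simp flip: t(2))
  moreover have "card (insert t T) = Suc k"
    using T(1,2) t(1) assms(1) by (simp add: finite_subset)
  ultimately show ?case
    using T(1,3) t(1) by (intro exI[of _ "insert t T"]) auto
qed

text \<open>Induction on \<open>I\<close>: joining \<open>x\<close> to a set \<open>T\<close> of
  vertices changes the capacities, so \<open>q\<close> must be arbitrary. Stating the condition for
  all subsets \<open>S\<close>, rather than for prefixes of a sorted sequence, avoids any re-sorting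
  after the capacities drop.\<close>

lemma Gale_Ryser_le:
  fixes p :: "'a \<Rightarrow> nat" and q :: "'b \<Rightarrow> nat"
  assumes "finite I" and "finite J"
    and "\<And>S. S \<subseteq> I \<Longrightarrow> (\<Sum>i\<in>S. p i) \<le> (\<Sum>j\<in>J. min (q j) (card S))"
  shows "\<exists>E\<subseteq>I \<times> J. (\<forall>i\<in>I. card {j\<in>J. (i, j) \<in> E} = p i) \<and>
                     (\<forall>j\<in>J. card {i\<in>I. (i, j) \<in> E} \<le> q j)"
  using assms(1,3)
proof (induction I arbitrary: q rule: finite_induct)
  case empty
  show ?case by (rule exI[of _ "{}"]) simp
next
  case (insert x I)
  let ?J = "{j\<in>J. 1 \<le> q j}"
  \<comment> \<open>The condition for the singleton \<open>{x}\<close> says that at least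
    \<open>p x\<close> vertices still have positive capacity.\<close>
  have "p x \<le> (\<Sum>j\<in>J. min (q j) 1)"
    using insert.prems[of "{x}"] by simp
  also have "\<dots> = (\<Sum>j\<in>J. if 1 \<le> q j then 1 else 0)"
    by (intro sum.cong) auto
  also have "\<dots> = card ?J"
    using assms(2) by (simp add: sum.If_cases Int_def)
  finally have "p x \<le> card ?J" .
  then obtain T where T: "T \<subseteq> ?J" "card T = p x" and
    top: "\<forall>j\<in>T. \<forall>j'\<in>?J - T. q j' \<le> q j"
    using ex_largest_subset[of ?J "p x" q] assms(2) by auto
  have pos: "1 \<le> q j" if "j \<in> T" for j
    using T(1) that by auto
  have TJ: "T \<subseteq> J"
    using T(1) by auto
  define q' where "q' j = (if j \<in> T then q j - 1 else q j)" for j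
  have "(\<Sum>i\<in>S. p i) \<le> (\<Sum>j\<in>J. min (q' j) (card S))" if S: "S \<subseteq> I" for S
  proof (cases "\<forall>j\<in>T. card S < q j")
    case True
    \<comment> \<open>Here \<open>q j - 1\<close> is still at least \<open>card S\<close> for
      \<open>j \<in> T\<close>, so the truncated capacities do not change.\<close>
    then have "(\<Sum>j\<in>J. min (q' j) (card S)) = (\<Sum>j\<in>J. min (q j) (card S))"
      by (intro sum.cong) (auto simp: q'_def)
    then show ?thesis
      using insert.prems[of S] S by auto
  next
    \<comment> \<open>Now \<open>T\<close> contains every \<open>j\<close> with \<open>q j > card S\<close>, so the condition for \<open>insert x S\<close> pays for
      both \<open>S\<close> and \<open>x\<close>.\<close>
    case False
    then obtain j\<^sub>0 where j\<^sub>0: "j\<^sub>0 \<in> T" "q j\<^sub>0 \<le> card S"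
      by force
    \<comment> \<open>A \<open>j\<close> outside \<open>T\<close> has capacity 0 or competed with
      \<open>j\<^sub>0\<close> and lost.\<close>
    have rest: "q j \<le> card S" if "j \<in> J - T" for j
      using top j\<^sub>0 that by (cases "1 \<le> q j") (auto intro: order_trans)
    have fin: "finite S"
      using S insert.hyps(1) finite_subset by auto
    have xS: "x \<notin> S"
      using S insert.hyps(2) by auto
    have "p x + (\<Sum>i\<in>S. p i) = (\<Sum>i\<in>insert x S. p i)"
      using fin xS by simp
    also have "\<dots> \<le> (\<Sum>j\<in>J. min (q j) (Suc (card S)))"
      using insert.prems[of "insert x S"] S fin xS by (auto simp: insert_mono)
    also have "\<dots> = (\<Sum>j\<in>J. min (q' j) (card S) + (if j \<in> T then 1 else 0))"
    proof (rule sum.cong)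
      fix j assume "j \<in> J"
      \<comment> \<open>On \<open>T\<close>, positivity of \<open>q j\<close> lets a unit be taken
        out of both arguments of \<open>min\<close>. Off \<open>T\<close>, \<open>rest\<close> makes
        both minima equal to \<open>q j\<close>.\<close>
      then show "min (q j) (Suc (card S)) = min (q' j) (card S) + (if j \<in> T then 1 else 0)"
        using pos[of j] rest[of j] by (auto simp: q'_def)
    qed simp
    also have "\<dots> = (\<Sum>j\<in>J. min (q' j) (card S)) + p x"
      using assms(2) TJ T(2) by (simp add: sum.distrib sum.If_cases Int_absorb1)
    finally show ?thesis by simp
  qed
  from insert.IH[OF this] obtain E where E: "E \<subseteq> I \<times> J"
    "\<forall>i\<in>I. card {j\<in>J. (i, j) \<in> E} = p i"
    "\<forall>j\<in>J. card {i\<in>I. (i, j) \<in> E} \<le> q' j"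
    by auto
  let ?E = "E \<union> {x} \<times> T"
  have "card {j\<in>J. (i, j) \<in> ?E} = p i" if "i \<in> insert x I" for i
  proof (cases "i = x")
    case True
    then have "{j\<in>J. (i, j) \<in> ?E} = T"
      using E(1) TJ insert.hyps(2) by auto
    then show ?thesis using T(2) True by simp
  next
    case False
    then show ?thesis using E(2) that by simp
  qed
  moreover have "card {i\<in>insert x I. (i, j) \<in> ?E} \<le> q j" if "j \<in> J" for j
  proof (cases "j \<in> T")
    case True
    then have "{i\<in>insert x I. (i, j) \<in> ?E} = insert x {i\<in>I. (i, j) \<in> E}"
      using E(1) insert.hyps(2) by auto
    then have "card {i\<in>insert x I. (i, j) \<in> ?E} = Suc (card {i\<in>I. (i, j) \<in> E})"
      using insert.hyps by simp
    then show ?thesis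
      using E(3) that True pos[of j] by (force simp: q'_def)
  next
    case False
    then have "{i\<in>insert x I. (i, j) \<in> ?E} = {i\<in>I. (i, j) \<in> E}"
      using E(1) insert.hyps(2) by auto
    then show ?thesis
      using E(3) that False by (auto simp: q'_def)
  qed
  moreover have "?E \<subseteq> insert x I \<times> J"
    using E(1) TJ by auto
  ultimately show ?case by blast
qed

text \<open>Counting \<open>E\<close> by rows and by columns shows that the column degrees have the
  same total as \<open>q\<close>, so no capacity can be left over.\<close>

theorem Gale_Ryser:
  fixes p :: "'a \<Rightarrow> nat" and q :: "'b \<Rightarrow> nat"
  assumes "finite I" and "finite J"
    and "\<And>S. S \<subseteq> I \<Longrightarrow> (\<Sum>i\<in>S. p i) \<le> (\<Sum>j\<in>J. min (q j) (card S))"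
    and "(\<Sum>i\<in>I. p i) = (\<Sum>j\<in>J. q j)"
  shows "\<exists>E\<subseteq>I \<times> J. (\<forall>i\<in>I. card {j\<in>J. (i, j) \<in> E} = p i) \<and>
                     (\<forall>j\<in>J. card {i\<in>I. (i, j) \<in> E} = q j)"
proof -
  obtain E where E: "E \<subseteq> I \<times> J" "\<forall>i\<in>I. card {j\<in>J. (i, j) \<in> E} = p i"
    "\<forall>j\<in>J. card {i\<in>I. (i, j) \<in> E} \<le> q j"
    using Gale_Ryser_le[OF assms(1-3)] by auto
  have "(\<Sum>j\<in>J. card {i\<in>I. (i, j) \<in> E}) = (\<Sum>i\<in>I. p i)"
    using E(2) sum_multicount_gen[OF assms(1,2), of "\<lambda>i j. (i, j) \<in> E" "\<lambda>j. card {i\<in>I. (i, j) \<in> E}"]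
    by simp
  then have eq: "(\<Sum>j\<in>J. card {i\<in>I. (i, j) \<in> E}) = (\<Sum>j\<in>J. q j)"
    using assms(4) by simp
  have "\<forall>j\<in>J. card {i\<in>I. (i, j) \<in> E} = q j"
  proof (rule ccontr)
    assume "\<not> ?thesis"
    then obtain j where "j \<in> J" "card {i\<in>I. (i, j) \<in> E} < q j"
      using E(3) le_neq_implies_less by blast
    then have "(\<Sum>j\<in>J. card {i\<in>I. (i, j) \<in> E}) < (\<Sum>j\<in>J. q j)"
      using E(3) assms(2) by (intro sum_strict_mono_ex1) auto
    with eq show False by simp
  qed
  with E show ?thesis by blast
qed

text \<open>The vertex for column \<open>j\<close> is \<open>m + j\<close>, which keeps the two
  sides disjoint; adding the converse of \<open>A\<close> makes the arcs symmetric.\<close>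

lemma bigraphicI:
  assumes "E \<subseteq> {1..m} \<times> {1..n}"
    and "\<And>i. i \<in> {1..m} \<Longrightarrow> card {j\<in>{1..n}. (i, j) \<in> E} = p i"
    and "\<And>j. j \<in> {1..n} \<Longrightarrow> card {i\<in>{1..m}. (i, j) \<in> E} = q j"
  shows "bigraphic m n p q"
proof -
  define A where "A = (\<lambda>(i, j). (i, m + j)) ` E"
  define G where "G = \<lparr>pverts = {1..m} \<union> (+) m ` {1..n}, parcs = A \<union> A\<inverse>\<rparr>"
  have A: "A \<subseteq> {1..m} \<times> (+) m ` {1..n}"
    using assms(1) by (auto simp: A_def)
  have disj: "{1..m} \<inter> (+) m ` {1..n} = {}"
    by auto
  have "finite A"
    using A by (rule finite_subset) auto
  then have "pair_graph G"
    using A disj by unfold_locales (auto simp: G_def symmetric_def sym_def)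
  then have bip: "bipartite G ((\<lambda>i. i) ` {1..m}) ((+) m ` {1..n})"
    unfolding bipartite_def using A disj by (auto simp: G_def)
  have deg: "degree G v = card {e\<in>A \<union> A\<inverse>. fst e = v}" for v
    by (simp add: degree_def out_degree_def out_arcs_def G_def)
  have "degree G i = p i" if i: "i \<in> {1..m}" for i
  proof -
    \<comment> \<open>Arcs in the converse of \<open>A\<close> start above \<open>m\<close>, so only
      arcs of \<open>A\<close> leave \<open>i\<close>.\<close>
    have "{e\<in>A \<union> A\<inverse>. fst e = i} = (\<lambda>j. (i, m + j)) ` {j\<in>{1..n}. (i, j) \<in> E}"
      using i assms(1) by (auto simp: A_def)
    then show ?thesis
      using assms(2)[OF i] by (simp add: deg card_image inj_on_def)
  qed
  moreover have "degree G (m + j) = q j" if j: "j \<in> {1..n}" for j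
  proof -
    have "{e\<in>A \<union> A\<inverse>. fst e = m + j} = (\<lambda>i. (m + j, i)) ` {i\<in>{1..m}. (i, j) \<in> E}"
      using j assms(1) by (auto simp: A_def)
    then show ?thesis
      using assms(3)[OF j] by (simp add: deg card_image inj_on_def)
  qed
  ultimately show ?thesis
    unfolding bigraphic_def using bip
    by (intro exI[of _ G] exI[of _ "\<lambda>i. i"] exI[of _ "(+) m"]) simp
qed

text \<open>Elements are added in increasing order. The new maximum \<open>x\<close> is at least the
  size of the enlarged set, so \<open>b x\<close> is at most the next term of the initial
  sum.\<close>

lemma sum_subset_le_sum_initial:
  fixes b :: "nat \<Rightarrow> 'b::ordered_comm_monoid_add"
  assumes "antimono_on {1..m} b" and "S \<subseteq> {1..m}"
  shows "(\<Sum>i\<in>S. b i) \<le> (\<Sum>i=1..card S. b i)"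
proof -
  have "finite S"
    using assms(2) by (rule finite_subset) simp
  then show ?thesis
    using assms(2)
  proof (induction S rule: finite_linorder_max_induct)
    case empty
    show ?case by simp
  next
    case (insert x S)
    have "insert x S \<subseteq> {1..x}"
      using insert.hyps(2) insert.prems by force
    then have "card (insert x S) \<le> x"
      using card_mono[of "{1..x}" "insert x S"] by simp
    moreover have card: "card (insert x S) = Suc (card S)"
      using insert.hyps by force
    ultimately have "b x \<le> b (Suc (card S))"
      using insert.prems by (intro monotone_onD[OF assms(1)]) auto
    moreover have "x \<notin> S"
      using insert.hyps(2) by auto
    ultimately show ?case
      using insert by (simp add: add.commute add_mono)
  qed
qed

theorem theorem1p3:
  fixes m n :: nat and a b c d :: "nat \<Rightarrow> nat"
  assumes "m \<ge> 1" and "n \<ge> 1"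
    and "\<And>i. i \<in> {1..m} \<Longrightarrow> a i \<le> b i"
    and "\<And>j. j \<in> {1..n} \<Longrightarrow> c j \<le> d j"
    and "antimono_on {1..m} b"
    and "antimono_on {1..n} d"
    and "\<And>k. k \<in> {1..m} \<Longrightarrow> (\<Sum>i=1..k. b i) \<le> (\<Sum>i=1..n. min (c i) k)"
    and "\<And>l. l \<in> {1..n} \<Longrightarrow> (\<Sum>i=1..l. d i) \<le> (\<Sum>i=1..m. min (a i) l)"
  shows "\<forall>p q :: nat \<Rightarrow> nat.
           (\<forall>i\<in>{1..m}. a i \<le> p i \<and> p i \<le> b i) \<longrightarrow>
           (\<forall>j\<in>{1..n}. c j \<le> q j \<and> q j \<le> d j) \<longrightarrow>
           (\<Sum>i=1..m. p i) = (\<Sum>j=1..n. q j) \<longrightarrow>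
           bigraphic m n p q"
proof (intro allI impI)
  fix p q :: "nat \<Rightarrow> nat"
  assume p: "\<forall>i\<in>{1..m}. a i \<le> p i \<and> p i \<le> b i"
    and q: "\<forall>j\<in>{1..n}. c j \<le> q j \<and> q j \<le> d j"
    and eq: "(\<Sum>i=1..m. p i) = (\<Sum>j=1..n. q j)"
  have "(\<Sum>i\<in>S. p i) \<le> (\<Sum>j\<in>{1..n}. min (q j) (card S))" if S: "S \<subseteq> {1..m}" for S
  \<comment> \<open>The assumed inequalities start at \<open>k = 1\<close>, so the empty set is
    treated separately.\<close>
  proof (cases "S = {}")
    case False
    then have "card S \<in> {1..m}"
      using S card_mono[of "{1..m}" S] finite_subset[OF S] by (simp add: Suc_le_eq card_gt_0_iff)
    have "(\<Sum>i\<in>S. p i) \<le> (\<Sum>i\<in>S. b i)"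
      using p S by (intro sum_mono) auto
    also have "\<dots> \<le> (\<Sum>i=1..card S. b i)"
      using assms(5) S by (rule sum_subset_le_sum_initial)
    also have "\<dots> \<le> (\<Sum>j=1..n. min (c j) (card S))"
      using \<open>card S \<in> {1..m}\<close> by (rule assms(7))
    also have "\<dots> \<le> (\<Sum>j=1..n. min (q j) (card S))"
      using q by (intro sum_mono min.mono) auto
    finally show ?thesis .
  qed simp
  then obtain E where "E \<subseteq> {1..m} \<times> {1..n}"
    "\<forall>i\<in>{1..m}. card {j\<in>{1..n}. (i, j) \<in> E} = p i"
    "\<forall>j\<in>{1..n}. card {i\<in>{1..m}. (i, j) \<in> E} = q j"
    using Gale_Ryser[of "{1..m}" "{1..n}" p q] eq by auto
  then show "bigraphic m n p q"
    by (intro bigraphicI[of E]) auto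
qed

end
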